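(* Let $\delta>0$, $p\in(0,1)$ and let $T>0$ be an integer. Let $(\lambda_x^i)_{i=0}^T$ and $(\lambda_y^i)_{i=0}^T$ be increasing sequences of positive numbers, with the convention $\lambda_x^{-1}=\lambda_y^{-1}=0$. Then with probability at least $1-p$, the point $(x_{T+1}^c,y_{T+1}^c)=\text{PB-SSP}(\delta,p,T)$ satisfies $$\Delta_{\Phi}(x_{T+1}^c,y_{T+1}^c) \le \delta\left(2+\sum_{i=0}^T\left(\frac{\lambda_x^i}{\mu_x+\lambda_x^{i-1}}+\frac{\lambda_y^i}{\mu_y+\lambda_y^{i-1}}\right)\right).$$
   Context: $\|\cdot\|$ is the Euclidean norm. Unconstrained setting: $\mathcal X=\mathbb R^{d_x}$, $\mathcal Y=\mathbb R^{d_y}$, $\xi$ is a random variable with distribution $\mathcal P$, and $\Phi(x,y)=\mathbb E[\Phi_\xi(x,y)]$. Assumption (SC-SC): there are $\mu_x,\mu_y>0$ such that for almost every $\xi$, $\Phi_\xi(\cdot,y)$ is $\mu_x$-strongly convex for every $y\in\mathcal Y$ and $\Phi_\xi(x,\cdot)$ is $\mu_y$-strongly concave for every $x\in\mathcal X$. Assumption (smoothness): there are $L_x,L_y,L_{xy}>0$ such that for all $x_1,x_2\in\mathcal X$, $y_1,y_2\in\mathcal Y$: $\|\nabla_x \Phi(x_1,y_1)-\nabla_x\Phi(x_2,y_1)\|\le L_x\|x_1-x_2\|$, $\|\nabla_y \Phi(x_1,y_1)-\nabla_y\Phi(x_1,y_2)\|\le L_y\|y_1-y_2\|$, $\|\nabla_x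 \Phi(x_1,y_1)-\nabla_x\Phi(x_1,y_2)\|\le L_{xy}\|y_1-y_2\|$, $\|\nabla_y \Phi(x_1,y_1)-\nabla_y\Phi(x_2,y_1)\|\le L_{xy}\|x_1-x_2\|$. Notation: $f(x):=\max_{y\in\mathcal Y}\Phi(x,y)$, $g(y):=\min_{x\in\mathcal X}\Phi(x,y)$, and the duality gap is $\Delta_\Phi(\hat x,\hat y):=f(\hat x)-g(\hat y)$. Given centers $x_i^c\in\mathcal X$, $y_i^c\in\mathcal Y$, set $f^i(x):=f(x)+\frac{\lambda_x^i}{2}\|x-x_i^c\|^2$, $g^i(y):=g(y)-\frac{\lambda_y^i}{2}\|y-y_i^c\|^2$ for $i=0,\dots,T$, and $f^{-1}:=f$, $g^{-1}:=g$. For $i=0,\dots,T+1$, $x_i^*:=\arg\min_{x} f^{i-1}(x)$ and $y_i^*:=\arg\max_{y} g^{i-1}(y)$ (these depend on the centers $x_{i-1}^c,y_{i-1}^c$, which are in general random). Procedure PB-SSP$(\delta,p,T)$: for $i=0,\dots,T$ (sequentially), set $\epsilon_x^i=\sqrt{2\delta/(\mu_x+\lambda_x^{i-1})}$, $\epsilon_y^i=\sqrt{2\delta/(\mu_y+\lambda_y^{i-1})}$ and generate (by any means) a random point $(x_i^c,y_i^c)$ satisfying $\mathbb P[\|x_i^c-x_i^*\|\le\epsilon_x^i]\ge 1-\frac{p}{2T+4}$ and $\mathbb P[\|y_i^c-y_i^*\|\le\epsilon_y^i]\ge 1-\frac{p}{2T+4}$. Finally generate (by any means) a random point $(x_{T+1}^c,y_{T+1}^c)$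 satisfying $\mathbb P[f^T(x_{T+1}^c)-f^T(x_{T+1}^* )\le\delta]\ge 1-\frac{p}{2T+4}$ and $\mathbb P[g^T(y_{T+1}^* )-g^T(y_{T+1}^c)\le\delta]\ge 1-\frac{p}{2T+4}$, and return $(x_{T+1}^c,y_{T+1}^c)$. *)

theory Defs
  imports "HOL-Probability.Probability"
begin

definition strongly_convex :: "real \<Rightarrow> ('a::real_inner \<Rightarrow> real) \<Rightarrow> bool" where
  "strongly_convex \<mu> f \<longleftrightarrow>
     (\<forall>x y. \<forall>t\<in>{0..1}. f ((1 - t) *\<^sub>R x + t *\<^sub>R y)
        \<le> (1 - t) * f x + t * f y - \<mu> / 2 * t * (1 - t) * (norm (x - y))\<^sup>2)"

definition strongly_concave :: "real \<Rightarrow> ('a::real_inner \<Rightarrow> real) \<Rightarrow> bool" where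
  "strongly_concave \<mu> f \<longleftrightarrow> strongly_convex \<mu> (\<lambda>x. - f x)"

text \<open>Here \<open>\<phi> \<xi> x y\<close> is the stochastic objective, and \<open>P\<close> is the distribution of \<open>\<xi>\<close>.\<close>

definition sc_sc :: "'s measure \<Rightarrow> ('s \<Rightarrow> 'a::real_inner \<Rightarrow> 'b::real_inner \<Rightarrow> real)
    \<Rightarrow> real \<Rightarrow> real \<Rightarrow> bool" where
  "sc_sc P \<phi> \<mu>x \<mu>y \<longleftrightarrow> \<mu>x > 0 \<and> \<mu>y > 0 \<and>
     (AE \<xi> in P. (\<forall>y. strongly_convex \<mu>x (\<lambda>x. \<phi> \<xi> x y))
                \<and> (\<forall>x. strongly_concave \<mu>y (\<lambda>y. \<phi> \<xi> x y)))"

text \<open>\<open>Gx\<close> and \<open>Gy\<close> are the (unique) partial gradients of \<open>\<Phi>\<close>.\<close>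

definition smooth :: "('a::real_inner \<Rightarrow> 'b::real_inner \<Rightarrow> real)
    \<Rightarrow> real \<Rightarrow> real \<Rightarrow> real \<Rightarrow> bool" where
  "smooth \<Phi> Lx Ly Lxy \<longleftrightarrow> Lx > 0 \<and> Ly > 0 \<and> Lxy > 0 \<and>
     (\<exists>Gx Gy.
        (\<forall>x y. GDERIV (\<lambda>u. \<Phi> u y) x :> Gx x y) \<and>
        (\<forall>x y. GDERIV (\<lambda>v. \<Phi> x v) y :> Gy x y) \<and>
        (\<forall>x1 x2 y1 y2.
           norm (Gx x1 y1 - Gx x2 y1) \<le> Lx * norm (x1 - x2) \<and>
           norm (Gy x1 y1 - Gy x1 y2) \<le> Ly * norm (y1 - y2) \<and>
           norm (Gx x1 y1 - Gx x1 y2) \<le> Lxy * norm (y1 - y2) \<and>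
           norm (Gy x1 y1 - Gy x2 y1) \<le> Lxy * norm (x1 - x2)))"

text \<open>The functions \<open>f\<close> and \<open>g\<close>.  \<open>GREATEST\<close> and \<open>LEAST\<close> denote an attained maximum and
  minimum; they are unspecified where none is attained.\<close>

definition primal :: "('a \<Rightarrow> 'b \<Rightarrow> real) \<Rightarrow> 'a \<Rightarrow> real" where
  "primal \<Phi> x = (GREATEST v. v \<in> range (\<lambda>y. \<Phi> x y))"

definition dual :: "('a \<Rightarrow> 'b \<Rightarrow> real) \<Rightarrow> 'b \<Rightarrow> real" where
  "dual \<Phi> y = (LEAST v. v \<in> range (\<lambda>x. \<Phi> x y))"

definition duality_gap :: "('a \<Rightarrow> 'b \<Rightarrow> real) \<Rightarrow> 'a \<Rightarrow> 'b \<Rightarrow> real" where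
  "duality_gap \<Phi> x y = primal \<Phi> x - dual \<Phi> y"

definition primal_reg :: "('a::real_inner \<Rightarrow> 'b \<Rightarrow> real) \<Rightarrow> real \<Rightarrow> 'a \<Rightarrow> 'a \<Rightarrow> real" where
  "primal_reg \<Phi> l c x = primal \<Phi> x + l / 2 * (norm (x - c))\<^sup>2"

definition dual_reg :: "('a \<Rightarrow> 'b::real_inner \<Rightarrow> real) \<Rightarrow> real \<Rightarrow> 'b \<Rightarrow> 'b \<Rightarrow> real" where
  "dual_reg \<Phi> l c y = dual \<Phi> y - l / 2 * (norm (y - c))\<^sup>2"

text \<open>\<open>preceding lam i\<close> is \<open>lam\<close> at index \<open>i - 1\<close>, with value 0 at index \<open>-1\<close>.\<close>

definition preceding :: "(nat \<Rightarrow> real) \<Rightarrow> nat \<Rightarrow> real" where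
  "preceding lam i = (case i of 0 \<Rightarrow> 0 | Suc j \<Rightarrow> lam j)"

text \<open>The optimizers at stage \<open>i\<close>, which belong to the objective with index \<open>i - 1\<close>, as
  functions of one realization \<open>c\<close> of the centers.\<close>

definition x_star :: "('a::real_inner \<Rightarrow> 'b \<Rightarrow> real) \<Rightarrow> (nat \<Rightarrow> real) \<Rightarrow> (nat \<Rightarrow> 'a) \<Rightarrow> nat \<Rightarrow> 'a" where
  "x_star \<Phi> lam c i = (case i of
       0 \<Rightarrow> arg_min (primal \<Phi>) (\<lambda>_. True)
     | Suc j \<Rightarrow> arg_min (primal_reg \<Phi> (lam j) (c j)) (\<lambda>_. True))"

definition y_star :: "('a \<Rightarrow> 'b::real_inner \<Rightarrow> real) \<Rightarrow> (nat \<Rightarrow> real) \<Rightarrow> (nat \<Rightarrow> 'b) \<Rightarrow> nat \<Rightarrow> 'b" where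
  "y_star \<Phi> lam c i = (case i of
       0 \<Rightarrow> arg_max (dual \<Phi>) (\<lambda>_. True)
     | Suc j \<Rightarrow> arg_max (dual_reg \<Phi> (lam j) (c j)) (\<lambda>_. True))"

text \<open>\<open>(xc i, yc i)\<close>, for \<open>i \<le> T + 1\<close>, are the random points generated by one run of PB-SSP.  They
  live on a common probability space \<open>M\<close> and may depend on each other arbitrarily; the point with
  index \<open>T + 1\<close> is the output.\<close>

definition pb_ssp :: "'w measure \<Rightarrow> ('a::euclidean_space \<Rightarrow> 'b::euclidean_space \<Rightarrow> real)
    \<Rightarrow> real \<Rightarrow> real \<Rightarrow> (nat \<Rightarrow> real) \<Rightarrow> (nat \<Rightarrow> real) \<Rightarrow> real \<Rightarrow> real \<Rightarrow> nat
    \<Rightarrow> (nat \<Rightarrow> 'w \<Rightarrow> 'a) \<Rightarrow> (nat \<Rightarrow> 'w \<Rightarrow> 'b) \<Rightarrow> bool" where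
  "pb_ssp M \<Phi> \<mu>x \<mu>y lx ly \<delta> p T xc yc \<longleftrightarrow>
     (\<forall>i\<le>T + 1. xc i \<in> borel_measurable M \<and> yc i \<in> borel_measurable M) \<and>
     (\<forall>i\<le>T.
        \<P>(\<omega> in M. norm (xc i \<omega> - x_star \<Phi> lx (\<lambda>j. xc j \<omega>) i)
                   \<le> sqrt (2 * \<delta> / (\<mu>x + preceding lx i)))
          \<ge> 1 - p / (2 * real T + 4) \<and>
        \<P>(\<omega> in M. norm (yc i \<omega> - y_star \<Phi> ly (\<lambda>j. yc j \<omega>) i)
                   \<le> sqrt (2 * \<delta> / (\<mu>y + preceding ly i)))
          \<ge> 1 - p / (2 * real T + 4)) \<and>
     \<P>(\<omega> in M. primal_reg \<Phi> (lx T) (xc T \<omega>) (xc (T + 1) \<omega>)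
               - primal_reg \<Phi> (lx T) (xc T \<omega>) (x_star \<Phi> lx (\<lambda>j. xc j \<omega>) (T + 1)) \<le> \<delta>)
       \<ge> 1 - p / (2 * real T + 4) \<and>
     \<P>(\<omega> in M. dual_reg \<Phi> (ly T) (yc T \<omega>) (y_star \<Phi> ly (\<lambda>j. yc j \<omega>) (T + 1))
               - dual_reg \<Phi> (ly T) (yc T \<omega>) (yc (T + 1) \<omega>) \<le> \<delta>)
       \<ge> 1 - p / (2 * real T + 4)"

end

theory Submission
  imports Defs
begin

text \<open>
  Since \<open>x\<^sub>i\<^sub>+\<^sub>1\<^sup>*\<close> minimizes \<open>f\<^sup>i\<close>, evaluating \<open>f\<^sup>i\<close> at \<open>x\<^sub>i\<^sup>*\<close> instead costs only
  \<open>\<lambda>\<^sub>i / 2 * \<parallel>x\<^sub>i\<^sup>* - x\<^sub>i\<^sup>c\<parallel>\<^sup>2 \<le> \<delta> \<lambda>\<^sub>i / (\<mu> + \<lambda>\<^sub>i\<^sub>-\<^sub>1)\<close> on top of \<open>f (x\<^sub>i\<^sup>*) \<le> f\<^sup>i\<^sup>-\<^sup>1 (x\<^sub>i\<^sup>*)\<close>; these costs telescope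
  down to \<open>min f\<close>.  The dual bound is the primal bound for \<open>(y, x) \<mapsto> - \<Phi> x y\<close>, the two are joined by
  \<open>min f = max g\<close>, and a union bound over the \<open>2 T + 4\<close> events gives the probability.
\<close>

section \<open>Strongly convex functions\<close>

lemma strongly_convexD:
  "strongly_convex \<mu> f \<Longrightarrow> 0 \<le> t \<Longrightarrow> t \<le> 1 \<Longrightarrow>
    f ((1 - t) *\<^sub>R x + t *\<^sub>R y)
      \<le> (1 - t) * f x + t * f y - \<mu> / 2 * t * (1 - t) * (norm (x - y))\<^sup>2"
  unfolding strongly_convex_def by auto

lemma strongly_convex_imp_continuous_on:
  fixes f :: "'a::euclidean_space \<Rightarrow> real"
  assumes "strongly_convex \<mu> f" "\<mu> \<ge> 0"
  shows "continuous_on UNIV f"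
proof -
  have "convex_on UNIV f"
  proof (rule convex_onI)
    fix t :: real and x y :: 'a
    assume t: "0 < t" "t < 1"
    have "f ((1 - t) *\<^sub>R x + t *\<^sub>R y)
        \<le> (1 - t) * f x + t * f y - \<mu> / 2 * t * (1 - t) * (norm (x - y))\<^sup>2"
      using t by (intro strongly_convexD assms) auto
    moreover have "0 \<le> \<mu> / 2 * t * (1 - t) * (norm (x - y))\<^sup>2"
      using t assms by (intro mult_nonneg_nonneg) auto
    ultimately show "f ((1 - t) *\<^sub>R x + t *\<^sub>R y) \<le> (1 - t) * f x + t * f y"
      by linarith
  qed simp
  then show ?thesis
    by (rule convex_on_continuous[OF open_UNIV])
qed

lemma strongly_convex_add_square:
  assumes "strongly_convex \<mu> f"
  shows "strongly_convex (\<mu> + l) (\<lambda>x. f x + l / 2 * (norm (x - c))\<^sup>2)"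
  unfolding strongly_convex_def
proof (intro allI ballI)
  fix x y :: 'a and t :: real
  assume t: "t \<in> {0..1}"
  have "(norm ((1 - t) *\<^sub>R x + t *\<^sub>R y - c))\<^sup>2
      = (norm ((1 - t) *\<^sub>R (x - c) + t *\<^sub>R (y - c)))\<^sup>2"
    by (simp add: algebra_simps)
  also have "\<dots> = (1 - t) * (norm (x - c))\<^sup>2 + t * (norm (y - c))\<^sup>2
      - t * (1 - t) * (norm ((x - c) - (y - c)))\<^sup>2"
    unfolding power2_norm_eq_inner
    by (simp add: inner_add_left inner_add_right inner_diff_left inner_diff_right
        inner_commute algebra_simps)
  finally have *: "(norm ((1 - t) *\<^sub>R x + t *\<^sub>R y - c))\<^sup>2
      = (1 - t) * (norm (x - c))\<^sup>2 + t * (norm (y - c))\<^sup>2 - t * (1 - t) * (norm (x - y))\<^sup>2"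
    by simp
  have "f ((1 - t) *\<^sub>R x + t *\<^sub>R y)
      \<le> (1 - t) * f x + t * f y - \<mu> / 2 * t * (1 - t) * (norm (x - y))\<^sup>2"
    using t by (intro strongly_convexD assms) auto
  then show "f ((1 - t) *\<^sub>R x + t *\<^sub>R y) + l / 2 * (norm ((1 - t) *\<^sub>R x + t *\<^sub>R y - c))\<^sup>2
      \<le> (1 - t) * (f x + l / 2 * (norm (x - c))\<^sup>2) + t * (f y + l / 2 * (norm (y - c))\<^sup>2)
        - (\<mu> + l) / 2 * t * (1 - t) * (norm (x - y))\<^sup>2"
    unfolding * by (simp add: field_simps)
qed

lemma strongly_convex_attains_inf:
  fixes f :: "'a::euclidean_space \<Rightarrow> real"
  assumes sc: "strongly_convex \<mu> f" and \<mu>: "\<mu> > 0"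
  obtains x where "\<And>z. f x \<le> f z"
proof -
  have cont: "continuous_on S f" for S
    using strongly_convex_imp_continuous_on[OF sc] \<mu> continuous_on_subset by force
  obtain m where m: "\<And>u. norm u \<le> 1 \<Longrightarrow> m \<le> f u"
  proof -
    obtain u where "\<forall>z\<in>cball 0 1. f u \<le> f z"
      using continuous_attains_inf[OF compact_cball _ cont, of 0 1] by auto
    then show thesis
      using that by (metis mem_cball_0)
  qed
  define R where "R = 1 + 2 * (f 0 - m) / \<mu>"
  have R: "1 \<le> R"
    using m[of 0] \<mu> by (simp add: R_def)
  obtain x where x: "\<And>z. norm z \<le> R \<Longrightarrow> f x \<le> f z"
  proof -
    have "cball (0::'a) R \<noteq> {}"
      using R by simp
    then obtain x where "\<forall>z\<in>cball 0 R. f x \<le> f z"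
      using continuous_attains_inf[OF compact_cball _ cont, of 0 R] by auto
    then show thesis
      using that by (metis mem_cball_0)
  qed
  have "f x \<le> f z" for z
  proof (cases "norm z \<le> R")
    case True
    then show ?thesis by (rule x)
  next
    case False
    define r where "r = norm z"
    define t where "t = 1 / r"
    have r: "r > R" "r > 1"
      using False R by (auto simp: r_def)
    then have t: "0 \<le> t" "t \<le> 1" "t * r = 1"
      by (auto simp: t_def)
    have "norm (t *\<^sub>R z) \<le> 1"
      using t by (simp add: r_def)
    then have "m \<le> f (t *\<^sub>R z)"
      by (rule m)
    also have "\<dots> \<le> (1 - t) * f 0 + t * f z - \<mu> / 2 * t * (1 - t) * r\<^sup>2"
      using strongly_convexD[OF sc t(1,2), of 0 z] by (simp add: r_def)
    finally have "r * m \<le> r * ((1 - t) * f 0 + t * f z - \<mu> / 2 * t * (1 - t) * r\<^sup>2)"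
      using r by (intro mult_left_mono) auto
    also have "\<dots> = (r - t * r) * f 0 + t * r * f z - \<mu> / 2 * (t * r) * (r - t * r) * r"
      by (simp add: algebra_simps power2_eq_square)
    also have "\<dots> = (r - 1) * f 0 + f z - \<mu> / 2 * (r - 1) * r"
      unfolding t by simp
    finally have 1: "f 0 + r * (\<mu> / 2 * (r - 1) - (f 0 - m)) \<le> f z"
      by (simp add: algebra_simps)
    have "f 0 - m \<le> \<mu> / 2 * (r - 1)"
      using r(1) \<mu> by (simp add: R_def field_simps)
    then have "0 \<le> r * (\<mu> / 2 * (r - 1) - (f 0 - m))"
      using r by simp
    with 1 have "f 0 \<le> f z"
      by linarith
    moreover have "f x \<le> f 0"
      using R by (intro x) auto
    ultimately show ?thesis
      by linarith
  qed
  then show thesis by (rule that)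
qed

lemma strongly_convex_min_growth:
  assumes sc: "strongly_convex \<mu> f" and min: "\<And>z. f x \<le> f z"
  shows "f x + \<mu> / 2 * (norm (z - x))\<^sup>2 \<le> f z"
proof -
  define d where "d = \<mu> / 2 * (norm (z - x))\<^sup>2"
  have *: "(1 - t) * d \<le> f z - f x" if "0 < t" "t < 1" for t
  proof -
    have "f x \<le> f ((1 - t) *\<^sub>R x + t *\<^sub>R z)"
      by (rule min)
    also have "\<dots> \<le> (1 - t) * f x + t * f z - \<mu> / 2 * t * (1 - t) * (norm (x - z))\<^sup>2"
      using that by (intro strongly_convexD sc) auto
    finally have "t * ((1 - t) * d) \<le> t * (f z - f x)"
      by (simp add: d_def norm_minus_commute algebra_simps)
    then show ?thesis
      using that by simp
  qed
  have "((\<lambda>t. (1 - t) * d) \<longlongrightarrow> (1 - 0) * d) (at_right (0::real))"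
    by (intro tendsto_intros)
  moreover have "\<forall>\<^sub>F t in at_right (0::real). (1 - t) * d \<le> f z - f x"
    unfolding eventually_at_right_field using * by (intro exI[of _ 1]) auto
  ultimately have "(1 - 0) * d \<le> f z - f x"
    by (rule tendsto_upperbound) simp
  then show ?thesis
    by (simp add: d_def)
qed

lemma arg_min_le:
  fixes f :: "'a \<Rightarrow> 'b::linorder"
  assumes "\<And>z. f x \<le> f z"
  shows "f (arg_min f (\<lambda>_. True)) \<le> f z"
  using arg_minI[of "\<lambda>_. True" x f "\<lambda>y. f y \<le> f z"] assms
  by (meson leD not_le_imp_less)

lemma arg_max_eq_arg_min_uminus:
  fixes f :: "'a \<Rightarrow> real"
  shows "arg_max f P = arg_min (\<lambda>x. - f x) P"
  unfolding arg_max_def arg_min_def is_arg_max_def is_arg_min_def by simp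

section \<open>Strongly convex-strongly concave functions\<close>

locale strongly_convex_concave =
  fixes \<Phi> :: "'a::euclidean_space \<Rightarrow> 'b::euclidean_space \<Rightarrow> real"
    and \<mu>x \<mu>y :: real
  assumes \<mu>x_pos: "\<mu>x > 0" and \<mu>y_pos: "\<mu>y > 0"
    and strongly_convex_left: "strongly_convex \<mu>x (\<lambda>x. \<Phi> x y)"
    and strongly_concave_right: "strongly_concave \<mu>y (\<lambda>y. \<Phi> x y)"
begin

lemma swap: "strongly_convex_concave (\<lambda>y x. - \<Phi> x y) \<mu>y \<mu>x"
  using \<mu>x_pos \<mu>y_pos strongly_convex_left strongly_concave_right
  by unfold_locales (auto simp: strongly_concave_def)

lemma primal_attained:
  obtains y where "primal \<Phi> x = \<Phi> x y" "\<And>y'. \<Phi> x y' \<le> primal \<Phi> x"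
proof -
  obtain y where y: "\<And>y'. - \<Phi> x y \<le> - \<Phi> x y'"
    using strongly_convex_attains_inf[OF strongly_concave_right[unfolded strongly_concave_def] \<mu>y_pos]
    by metis
  have "primal \<Phi> x = \<Phi> x y"
    unfolding primal_def using y by (intro Greatest_equality) auto
  with y that show thesis by auto
qed

lemma le_primal: "\<Phi> x y \<le> primal \<Phi> x"
  by (metis primal_attained)

lemma strongly_convex_primal: "strongly_convex \<mu>x (primal \<Phi>)"
  unfolding strongly_convex_def
proof (intro allI ballI)
  fix x x' :: 'a and t :: real
  assume t: "t \<in> {0..1}"
  let ?z = "(1 - t) *\<^sub>R x + t *\<^sub>R x'"
  obtain y where y: "primal \<Phi> ?z = \<Phi> ?z y"
    by (metis primal_attained)
  have "\<Phi> ?z y \<le> (1 - t) * \<Phi> x y + t * \<Phi> x' y - \<mu>x / 2 * t * (1 - t) * (norm (x - x'))\<^sup>2"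
    using t strongly_convexD[OF strongly_convex_left[of y]] by auto
  also have "\<dots> \<le> (1 - t) * primal \<Phi> x + t * primal \<Phi> x'
      - \<mu>x / 2 * t * (1 - t) * (norm (x - x'))\<^sup>2"
    using t by (intro diff_right_mono add_mono mult_left_mono le_primal) auto
  finally show "primal \<Phi> ?z \<le> (1 - t) * primal \<Phi> x + t * primal \<Phi> x'
      - \<mu>x / 2 * t * (1 - t) * (norm (x - x'))\<^sup>2"
    using y by simp
qed

lemma dual_eq: "dual \<Phi> = (\<lambda>y. - primal (\<lambda>y x. - \<Phi> x y) y)"
proof
  fix y
  interpret s: strongly_convex_concave "\<lambda>y x. - \<Phi> x y" \<mu>y \<mu>x
    by (rule swap)
  obtain x where "primal (\<lambda>y x. - \<Phi> x y) y = - \<Phi> x y"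
      "\<And>x'. - \<Phi> x' y \<le> primal (\<lambda>y x. - \<Phi> x y) y"
    by (metis s.primal_attained)
  then show "dual \<Phi> y = - primal (\<lambda>y x. - \<Phi> x y) y"
    unfolding dual_def by (intro Least_equality) (auto simp: minus_le_iff)
qed

lemma dual_reg_eq: "dual_reg \<Phi> l c = (\<lambda>y. - primal_reg (\<lambda>y x. - \<Phi> x y) l c y)"
  by (simp add: fun_eq_iff dual_reg_def primal_reg_def dual_eq)

lemma y_star_eq: "y_star \<Phi> lam c i = x_star (\<lambda>y x. - \<Phi> x y) lam c i"
  by (simp add: y_star_def x_star_def arg_max_eq_arg_min_uminus dual_reg_eq dual_eq split: nat.split)

text \<open>With \<open>x\<close> a minimizer of the primal function, \<open>y\<close> its best response and \<open>Y t\<close> the best response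
  to \<open>(1 - t) x + t z\<close>, minimality of \<open>x\<close> gives \<open>primal \<Phi> x \<le> \<Phi> z (Y t)\<close> for all \<open>z\<close>, and strong
  concavity forces \<open>Y t \<rightarrow> y\<close> as \<open>t \<rightarrow> 0\<close>.\<close>

lemma minimax:
  obtains x y where "primal \<Phi> x = dual \<Phi> y"
proof -
  obtain x where x: "\<And>z. primal \<Phi> x \<le> primal \<Phi> z"
    using strongly_convex_attains_inf[OF strongly_convex_primal \<mu>x_pos] by metis
  obtain y where y: "primal \<Phi> x = \<Phi> x y" "\<And>y'. \<Phi> x y' \<le> primal \<Phi> x"
    by (metis primal_attained)
  have *: "primal \<Phi> x \<le> \<Phi> z y" for z
  proof -
    define X where "X t = (1 - t) *\<^sub>R x + t *\<^sub>R z" for t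
    have "\<exists>y. primal \<Phi> (X t) = \<Phi> (X t) y" for t
      by (metis primal_attained)
    then obtain Y where Y: "\<And>t. primal \<Phi> (X t) = \<Phi> (X t) (Y t)"
      by metis
    have cvx: "primal \<Phi> x \<le> (1 - t) * \<Phi> x (Y t) + t * \<Phi> z (Y t)" if "0 < t" "t < 1" for t
    proof -
      have "primal \<Phi> x \<le> \<Phi> (X t) (Y t)"
        using x Y by metis
      also have "\<dots> \<le> (1 - t) * \<Phi> x (Y t) + t * \<Phi> z (Y t)
          - \<mu>x / 2 * t * (1 - t) * (norm (x - z))\<^sup>2"
        unfolding X_def using that by (intro strongly_convexD strongly_convex_left) auto
      also have "\<dots> \<le> (1 - t) * \<Phi> x (Y t) + t * \<Phi> z (Y t)"
        using that \<mu>x_pos by simp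
      finally show ?thesis .
    qed
    have lower: "primal \<Phi> x \<le> \<Phi> z (Y t)" if "0 < t" "t < 1" for t
    proof -
      have "(1 - t) * \<Phi> x (Y t) \<le> (1 - t) * primal \<Phi> x"
        using that by (intro mult_left_mono le_primal) auto
      then have "t * primal \<Phi> x \<le> t * \<Phi> z (Y t)"
        using cvx[OF that] by (simp add: algebra_simps)
      then show ?thesis
        using that by simp
    qed
    have dist: "(norm (Y t - y))\<^sup>2 \<le> t / (1 - t) * (2 / \<mu>y * (primal \<Phi> z - primal \<Phi> x))"
      if "0 < t" "t < 1" for t
    proof -
      have "- \<Phi> x y + \<mu>y / 2 * (norm (Y t - y))\<^sup>2 \<le> - \<Phi> x (Y t)"
        using y by (intro strongly_convex_min_growth[OF
              strongly_concave_right[unfolded strongly_concave_def]]) auto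
      then have "(1 - t) * \<Phi> x (Y t) \<le> (1 - t) * (primal \<Phi> x - \<mu>y / 2 * (norm (Y t - y))\<^sup>2)"
        using that y by (intro mult_left_mono) auto
      moreover have "t * \<Phi> z (Y t) \<le> t * primal \<Phi> z"
        using that by (intro mult_left_mono le_primal) auto
      ultimately have "primal \<Phi> x
          \<le> (1 - t) * (primal \<Phi> x - \<mu>y / 2 * (norm (Y t - y))\<^sup>2) + t * primal \<Phi> z"
        using cvx[OF that] by linarith
      then have "(1 - t) * (\<mu>y / 2) * (norm (Y t - y))\<^sup>2 \<le> t * (primal \<Phi> z - primal \<Phi> x)"
        by (simp add: algebra_simps)
      then show ?thesis
        using that \<mu>y_pos by (simp add: field_simps)
    qed
    have ev: "\<forall>\<^sub>F t in at_right (0::real). 0 < t \<and> t < 1"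
      unfolding eventually_at_right_field by (intro exI[of _ 1]) auto
    have "((\<lambda>t. t / (1 - t) * (2 / \<mu>y * (primal \<Phi> z - primal \<Phi> x)))
        \<longlongrightarrow> 0 / (1 - 0) * (2 / \<mu>y * (primal \<Phi> z - primal \<Phi> x))) (at_right (0::real))"
      by (intro tendsto_intros) auto
    then have up: "((\<lambda>t. t / (1 - t) * (2 / \<mu>y * (primal \<Phi> z - primal \<Phi> x))) \<longlongrightarrow> 0)
        (at_right (0::real))"
      by simp
    have "((\<lambda>t. (norm (Y t - y))\<^sup>2) \<longlongrightarrow> 0) (at_right 0)"
    proof (rule tendsto_sandwich[OF _ _ tendsto_const up])
      show "\<forall>\<^sub>F t in at_right 0.
          (norm (Y t - y))\<^sup>2 \<le> t / (1 - t) * (2 / \<mu>y * (primal \<Phi> z - primal \<Phi> x))"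
        using ev by eventually_elim (use dist in blast)
    qed simp
    then have "((\<lambda>t. sqrt ((norm (Y t - y))\<^sup>2)) \<longlongrightarrow> sqrt 0) (at_right 0)"
      by (rule tendsto_real_sqrt)
    then have lim: "(Y \<longlongrightarrow> y) (at_right 0)"
      by (simp add: tendsto_norm_zero_iff LIM_zero_iff)
    have "continuous_on UNIV (\<lambda>y. - \<Phi> z y)"
      using strongly_convex_imp_continuous_on[OF strongly_concave_right[unfolded strongly_concave_def]]
        \<mu>y_pos by simp
    then have "continuous_on UNIV (\<lambda>y. - (- \<Phi> z y))"
      by (rule continuous_on_minus)
    then have "isCont (\<Phi> z) y"
      by (simp add: continuous_on_eq_continuous_at)
    then have "((\<lambda>t. \<Phi> z (Y t)) \<longlongrightarrow> \<Phi> z y) (at_right 0)"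
      using lim by (rule isCont_tendsto_compose)
    then show ?thesis
      by (rule tendsto_lowerbound) (use ev in \<open>auto elim!: eventually_mono intro: lower\<close>)
  qed
  have "dual \<Phi> y = \<Phi> x y"
    unfolding dual_def using * y by (intro Least_equality) auto
  with y show thesis
    using that by metis
qed

lemma x_star_0_le: "primal \<Phi> (x_star \<Phi> lam c 0) \<le> primal \<Phi> z"
proof -
  obtain x where "\<And>z. primal \<Phi> x \<le> primal \<Phi> z"
    using strongly_convex_attains_inf[OF strongly_convex_primal \<mu>x_pos] by metis
  then show ?thesis
    unfolding x_star_def nat.case by (rule arg_min_le)
qed

lemma x_star_Suc_le:
  assumes "lam j \<ge> 0"
  shows "primal_reg \<Phi> (lam j) (c j) (x_star \<Phi> lam c (Suc j)) \<le> primal_reg \<Phi> (lam j) (c j) z"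
proof -
  have "strongly_convex (\<mu>x + lam j) (primal_reg \<Phi> (lam j) (c j))"
    unfolding primal_reg_def by (rule strongly_convex_add_square[OF strongly_convex_primal])
  then obtain x where "\<And>z. primal_reg \<Phi> (lam j) (c j) x \<le> primal_reg \<Phi> (lam j) (c j) z"
    using strongly_convex_attains_inf \<mu>x_pos assms by (metis add_pos_nonneg)
  then show ?thesis
    unfolding x_star_def nat.case by (rule arg_min_le)
qed

lemma primal_le_primal_reg: "l \<ge> 0 \<Longrightarrow> primal \<Phi> x \<le> primal_reg \<Phi> l c x"
  by (simp add: primal_reg_def)

lemma primal_reg_x_star_le:
  assumes "\<delta> > 0" and lam: "\<And>i. i \<le> T \<Longrightarrow> lam i > 0"
    and near: "\<And>i. i \<le> T \<Longrightarrow>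
      norm (c i - x_star \<Phi> lam c i) \<le> sqrt (2 * \<delta> / (\<mu>x + preceding lam i))"
    and "j \<le> T"
  shows "primal_reg \<Phi> (lam j) (c j) (x_star \<Phi> lam c (Suc j))
    \<le> primal \<Phi> z + \<delta> * (\<Sum>i=0..j. lam i / (\<mu>x + preceding lam i))"
proof -
  have step: "primal_reg \<Phi> (lam j) (c j) (x_star \<Phi> lam c (Suc j))
      \<le> primal \<Phi> (x_star \<Phi> lam c j) + \<delta> * (lam j / (\<mu>x + preceding lam j))" if "j \<le> T" for j
  proof -
    have prec: "preceding lam j \<ge> 0"
      using lam[of "j - 1"] that by (auto simp: preceding_def split: nat.split)
    have "(norm (c j - x_star \<Phi> lam c j))\<^sup>2 \<le> (sqrt (2 * \<delta> / (\<mu>x + preceding lam j)))\<^sup>2"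
      using near[OF that] by (intro power_mono) auto
    then have "(norm (x_star \<Phi> lam c j - c j))\<^sup>2 \<le> 2 * \<delta> / (\<mu>x + preceding lam j)"
      using \<open>\<delta> > 0\<close> \<mu>x_pos prec by (simp add: norm_minus_commute)
    then have "lam j / 2 * (norm (x_star \<Phi> lam c j - c j))\<^sup>2
        \<le> lam j / 2 * (2 * \<delta> / (\<mu>x + preceding lam j))"
      using lam[OF that] by (intro mult_left_mono) auto
    moreover have "primal_reg \<Phi> (lam j) (c j) (x_star \<Phi> lam c (Suc j))
        \<le> primal_reg \<Phi> (lam j) (c j) (x_star \<Phi> lam c j)"
      using lam[OF that] by (intro x_star_Suc_le) auto
    ultimately show ?thesis
      by (simp add: primal_reg_def mult.commute)
  qed
  show ?thesis
    using \<open>j \<le> T\<close>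
  proof (induction j)
    case 0
    show ?case
      using step[of 0] x_star_0_le[of lam c z] by simp
  next
    case (Suc j)
    then have "primal \<Phi> (x_star \<Phi> lam c (Suc j))
        \<le> primal_reg \<Phi> (lam j) (c j) (x_star \<Phi> lam c (Suc j))"
      using lam[of j] by (intro primal_le_primal_reg) auto
    with Suc step[of "Suc j"] show ?case
      by (simp add: distrib_left preceding_def)
  qed
qed

lemma primal_output_le:
  assumes "\<delta> > 0" and lam: "\<And>i. i \<le> T \<Longrightarrow> lam i > 0"
    and near: "\<And>i. i \<le> T \<Longrightarrow>
      norm (c i - x_star \<Phi> lam c i) \<le> sqrt (2 * \<delta> / (\<mu>x + preceding lam i))"
    and last: "primal_reg \<Phi> (lam T) (c T) x
      - primal_reg \<Phi> (lam T) (c T) (x_star \<Phi> lam c (Suc T)) \<le> \<delta>"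
  shows "primal \<Phi> x \<le> primal \<Phi> z + \<delta> * (1 + (\<Sum>i=0..T. lam i / (\<mu>x + preceding lam i)))"
  using primal_reg_x_star_le[where T = T and j = T, OF assms(1-3) order_refl, where z = z] last
    primal_le_primal_reg[of "lam T" x "c T"] lam[of T]
  by (simp add: distrib_left)

lemma duality_gap_le:
  assumes "\<delta> > 0"
    and "\<And>i. i \<le> T \<Longrightarrow> lx i > 0" and "\<And>i. i \<le> T \<Longrightarrow> ly i > 0"
    and "\<And>i. i \<le> T \<Longrightarrow>
      norm (xc i - x_star \<Phi> lx xc i) \<le> sqrt (2 * \<delta> / (\<mu>x + preceding lx i))"
    and "\<And>i. i \<le> T \<Longrightarrow>
      norm (yc i - y_star \<Phi> ly yc i) \<le> sqrt (2 * \<delta> / (\<mu>y + preceding ly i))"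
    and "primal_reg \<Phi> (lx T) (xc T) x
      - primal_reg \<Phi> (lx T) (xc T) (x_star \<Phi> lx xc (Suc T)) \<le> \<delta>"
    and "dual_reg \<Phi> (ly T) (yc T) (y_star \<Phi> ly yc (Suc T)) - dual_reg \<Phi> (ly T) (yc T) y \<le> \<delta>"
  shows "duality_gap \<Phi> x y \<le> \<delta> * (2 + (\<Sum>i=0..T. lx i / (\<mu>x + preceding lx i)
                                                 + ly i / (\<mu>y + preceding ly i)))"
proof -
  interpret s: strongly_convex_concave "\<lambda>y x. - \<Phi> x y" \<mu>y \<mu>x
    by (rule swap)
  obtain x0 y0 where saddle: "primal \<Phi> x0 = dual \<Phi> y0"
    by (rule minimax)
  have "primal \<Phi> x \<le> primal \<Phi> x0 + \<delta> * (1 + (\<Sum>i=0..T. lx i / (\<mu>x + preceding lx i)))"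
    by (rule primal_output_le) (use assms in auto)
  moreover have "primal (\<lambda>y x. - \<Phi> x y) y \<le> primal (\<lambda>y x. - \<Phi> x y) y0
      + \<delta> * (1 + (\<Sum>i=0..T. ly i / (\<mu>y + preceding ly i)))"
    by (rule s.primal_output_le[where c = yc]) (use assms in \<open>auto simp: y_star_eq dual_reg_eq\<close>)
  ultimately show ?thesis
    using saddle by (simp add: duality_gap_def dual_eq sum.distrib distrib_left)
qed

lemma continuous_on_primal: "continuous_on UNIV (primal \<Phi>)"
  using strongly_convex_imp_continuous_on[OF strongly_convex_primal] \<mu>x_pos by simp

lemma continuous_on_dual: "continuous_on UNIV (dual \<Phi>)"
  unfolding dual_eq
  by (intro continuous_on_minus strongly_convex_concave.continuous_on_primal[OF swap])

lemma borel_measurable_duality_gap: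
  assumes "X \<in> borel_measurable M" "Y \<in> borel_measurable M"
  shows "(\<lambda>\<omega>. duality_gap \<Phi> (X \<omega>) (Y \<omega>)) \<in> borel_measurable M"
proof -
  have [measurable]: "primal \<Phi> \<in> borel_measurable borel" "dual \<Phi> \<in> borel_measurable borel"
    by (intro borel_measurable_continuous_onI continuous_on_primal continuous_on_dual)+
  show ?thesis
    unfolding duality_gap_def using assms by measurable
qed

end

section \<open>Expectations and the union bound\<close>

lemma strongly_convex_integral:
  fixes f :: "'s \<Rightarrow> 'a::real_inner \<Rightarrow> real"
  assumes "prob_space P"
    and int: "\<And>x. integrable P (\<lambda>\<xi>. f \<xi> x)"
    and sc: "AE \<xi> in P. strongly_convex \<mu> (f \<xi>)"
  shows "strongly_convex \<mu> (\<lambda>x. \<integral>\<xi>. f \<xi> x \<partial>P)"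
  unfolding strongly_convex_def
proof (intro allI ballI)
  interpret prob_space P by fact
  fix x y :: 'a and t :: real
  assume t: "t \<in> {0..1}"
  let ?c = "\<mu> / 2 * t * (1 - t) * (norm (x - y))\<^sup>2"
  have "(\<integral>\<xi>. f \<xi> ((1 - t) *\<^sub>R x + t *\<^sub>R y) \<partial>P) \<le> (\<integral>\<xi>. (1 - t) * f \<xi> x + t * f \<xi> y - ?c \<partial>P)"
  proof (rule integral_mono_AE)
    show "AE \<xi> in P. f \<xi> ((1 - t) *\<^sub>R x + t *\<^sub>R y) \<le> (1 - t) * f \<xi> x + t * f \<xi> y - ?c"
      using sc by eventually_elim (rule strongly_convexD, use t in auto)
    show "integrable P (\<lambda>\<xi>. (1 - t) * f \<xi> x + t * f \<xi> y - ?c)"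
      by (intro Bochner_Integration.integrable_diff Bochner_Integration.integrable_add
          integrable_mult_right integrable_const int)
  qed (rule int)
  also have "\<dots> = (1 - t) * (\<integral>\<xi>. f \<xi> x \<partial>P) + t * (\<integral>\<xi>. f \<xi> y \<partial>P) - ?c"
    by (simp add: int prob_space)
  finally show "(\<integral>\<xi>. f \<xi> ((1 - t) *\<^sub>R x + t *\<^sub>R y) \<partial>P)
      \<le> (1 - t) * (\<integral>\<xi>. f \<xi> x \<partial>P) + t * (\<integral>\<xi>. f \<xi> y \<partial>P) - ?c" .
qed

lemma strongly_convex_concave_expectation:
  assumes "prob_space P"
    and int: "\<And>x y. integrable P (\<lambda>\<xi>. \<phi> \<xi> x y)"
    and \<Phi>: "\<And>x y. \<Phi> x y = (\<integral>\<xi>. \<phi> \<xi> x y \<partial>P)"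
    and sc: "sc_sc P \<phi> \<mu>x \<mu>y"
  shows "strongly_convex_concave \<Phi> \<mu>x \<mu>y"
proof
  show "\<mu>x > 0" "\<mu>y > 0"
    using sc by (auto simp: sc_sc_def)
  show "strongly_convex \<mu>x (\<lambda>x. \<Phi> x y)" for y
    unfolding \<Phi> by (rule strongly_convex_integral[OF \<open>prob_space P\<close> int])
      (use sc in \<open>auto simp: sc_sc_def elim: eventually_mono\<close>)
  have "strongly_convex \<mu>y (\<lambda>y. \<integral>\<xi>. - \<phi> \<xi> x y \<partial>P)" for x
    by (rule strongly_convex_integral[OF \<open>prob_space P\<close>])
      (use sc int in \<open>auto simp: sc_sc_def strongly_concave_def elim: eventually_mono\<close>)
  then show "strongly_concave \<mu>y (\<lambda>y. \<Phi> x y)" for x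
    by (simp add: strongly_concave_def \<Phi>)
qed

lemma (in prob_space) prob_INT_ge:
  assumes "finite I" "I \<noteq> {}" and A: "\<And>i. i \<in> I \<Longrightarrow> A i \<in> events"
    and ge: "\<And>i. i \<in> I \<Longrightarrow> prob (A i) \<ge> 1 - q"
  shows "prob (\<Inter>i\<in>I. A i) \<ge> 1 - real (card I) * q"
proof -
  have "prob (space M - (\<Inter>i\<in>I. A i)) = prob (\<Union>i\<in>I. space M - A i)"
    using \<open>I \<noteq> {}\<close> by (intro arg_cong[where f = prob]) auto
  also have "\<dots> \<le> (\<Sum>i\<in>I. prob (space M - A i))"
    using assms by (intro finite_measure_subadditive_finite) auto
  also have "\<dots> \<le> (\<Sum>i\<in>I. q)"
    using ge A by (intro sum_mono) (force simp: prob_compl)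
  finally have "prob (space M - (\<Inter>i\<in>I. A i)) \<le> real (card I) * q"
    by simp
  moreover have "(\<Inter>i\<in>I. A i) \<in> events"
    using assms by (intro sets.finite_INT) auto
  ultimately show ?thesis
    by (simp add: prob_compl)
qed

theorem theorem1:
  fixes P :: "'s measure"
    and \<phi> :: "'s \<Rightarrow> real ^ 'm \<Rightarrow> real ^ 'n \<Rightarrow> real"
    and \<Phi> :: "real ^ 'm \<Rightarrow> real ^ 'n \<Rightarrow> real"
    and M :: "'w measure"
    and xc :: "nat \<Rightarrow> 'w \<Rightarrow> real ^ 'm"
    and yc :: "nat \<Rightarrow> 'w \<Rightarrow> real ^ 'n"
    and lx ly :: "nat \<Rightarrow> real"
    and \<mu>x \<mu>y Lx Ly Lxy \<delta> p :: real
    and T :: nat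
  assumes "prob_space P"
    and "\<And>x y. integrable P (\<lambda>\<xi>. \<phi> \<xi> x y)"
    and "\<And>x y. \<Phi> x y = (\<integral>\<xi>. \<phi> \<xi> x y \<partial>P)"
    and "sc_sc P \<phi> \<mu>x \<mu>y"
    and "smooth \<Phi> Lx Ly Lxy"
    and "\<delta> > 0" and "0 < p" and "p < 1" and "T > 0"
    and "\<And>i. i \<le> T \<Longrightarrow> lx i > 0" and "\<And>i. i \<le> T \<Longrightarrow> ly i > 0"
    and "mono_on {0..T} lx" and "mono_on {0..T} ly"
    and "prob_space M"
    and "pb_ssp M \<Phi> \<mu>x \<mu>y lx ly \<delta> p T xc yc"
  shows "\<P>(\<omega> in M. duality_gap \<Phi> (xc (T + 1) \<omega>) (yc (T + 1) \<omega>)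
            \<le> \<delta> * (2 + (\<Sum>i=0..T. lx i / (\<mu>x + preceding lx i)
                                + ly i / (\<mu>y + preceding ly i))))
         \<ge> 1 - p"
proof -
  interpret M: prob_space M by fact
  interpret strongly_convex_concave \<Phi> \<mu>x \<mu>y
    using assms(1-4) by (rule strongly_convex_concave_expectation)
  define q where "q = p / (2 * real T + 4)"
  define A where "A i = {\<omega> \<in> space M. if i \<le> T
      then norm (xc i \<omega> - x_star \<Phi> lx (\<lambda>j. xc j \<omega>) i) \<le> sqrt (2 * \<delta> / (\<mu>x + preceding lx i))
      else primal_reg \<Phi> (lx T) (xc T \<omega>) (xc (T + 1) \<omega>)
        - primal_reg \<Phi> (lx T) (xc T \<omega>) (x_star \<Phi> lx (\<lambda>j. xc j \<omega>) (T + 1)) \<le> \<delta>}" for i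
  define B where "B i = {\<omega> \<in> space M. if i \<le> T
      then norm (yc i \<omega> - y_star \<Phi> ly (\<lambda>j. yc j \<omega>) i) \<le> sqrt (2 * \<delta> / (\<mu>y + preceding ly i))
      else dual_reg \<Phi> (ly T) (yc T \<omega>) (y_star \<Phi> ly (\<lambda>j. yc j \<omega>) (T + 1))
        - dual_reg \<Phi> (ly T) (yc T \<omega>) (yc (T + 1) \<omega>) \<le> \<delta>}" for i
  define E where "E = case_sum A B"
  define I where "I = {..T + 1} <+> {..T + 1}"
  have AB: "measure M (A i) \<ge> 1 - q" "measure M (B i) \<ge> 1 - q" for i
    using assms(15) unfolding pb_ssp_def A_def B_def q_def by (cases "i \<le> T"; simp)+
  have ge: "measure M (E k) \<ge> 1 - q" for k
    using AB by (cases k) (simp_all add: E_def)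
  have "q < 1"
    using \<open>p < 1\<close> by (simp add: q_def field_simps)
  \<comment> \<open>non-measurable sets have \<open>measure\<close> 0\<close>
  then have events: "E k \<in> M.events" for k
    using ge[of k] measure_notin_sets[of "E k" M] by fastforce
  have fin: "finite I" "I \<noteq> {}" "card I = 2 * T + 4"
    by (auto simp: I_def card_Plus)
  let ?G = "{\<omega> \<in> space M. duality_gap \<Phi> (xc (T + 1) \<omega>) (yc (T + 1) \<omega>)
      \<le> \<delta> * (2 + (\<Sum>i=0..T. lx i / (\<mu>x + preceding lx i) + ly i / (\<mu>y + preceding ly i)))}"
  have "1 - p = 1 - real (card I) * q"
    by (simp add: fin q_def field_simps)
  also have "\<dots> \<le> measure M (\<Inter>k\<in>I. E k)"
    by (rule M.prob_INT_ge) (use fin events ge in auto)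
  also have "\<dots> \<le> measure M ?G"
  proof (rule M.finite_measure_mono)
    show "(\<Inter>k\<in>I. E k) \<subseteq> ?G"
    proof
      fix \<omega> assume \<omega>: "\<omega> \<in> (\<Inter>k\<in>I. E k)"
      have in_AB: "\<omega> \<in> A i" "\<omega> \<in> B i" if "i \<le> T + 1" for i
        using INT_D[OF \<omega>, of "Inl i"] INT_D[OF \<omega>, of "Inr i"] that by (auto simp: I_def E_def)
      have "duality_gap \<Phi> (xc (T + 1) \<omega>) (yc (T + 1) \<omega>)
        \<le> \<delta> * (2 + (\<Sum>i=0..T. lx i / (\<mu>x + preceding lx i) + ly i / (\<mu>y + preceding ly i)))"
      proof (rule duality_gap_le[where xc = "\<lambda>j. xc j \<omega>" and yc = "\<lambda>j. yc j \<omega>"])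
        fix i assume "i \<le> T"
        then show "norm (xc i \<omega> - x_star \<Phi> lx (\<lambda>j. xc j \<omega>) i) \<le> sqrt (2 * \<delta> / (\<mu>x + preceding lx i))"
          and "norm (yc i \<omega> - y_star \<Phi> ly (\<lambda>j. yc j \<omega>) i) \<le> sqrt (2 * \<delta> / (\<mu>y + preceding ly i))"
          using in_AB[of i] by (auto simp: A_def B_def)
      qed (use assms in_AB[of "T + 1"] in \<open>auto simp: A_def B_def\<close>)
      then show "\<omega> \<in> ?G"
        using in_AB[of 0] by (auto simp: A_def)
    qed
    have "xc (T + 1) \<in> borel_measurable M" "yc (T + 1) \<in> borel_measurable M"
      using assms(15) by (auto simp: pb_ssp_def)
    then have [measurable]: "(\<lambda>\<omega>. duality_gap \<Phi> (xc (T + 1) \<omega>) (yc (T + 1) \<omega>)) \<in> borel_measurable M"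
      by (rule borel_measurable_duality_gap)
    show "?G \<in> M.events"
      by measurable
  qed
  finally show ?thesis .
qed

end
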